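(* Suppose $G_0\Supset G_1\Supset\cdots\Supset G_m$ are bounded connected domains in $\mathbb C$, each containing the origin, and let $\epsilon_1$ be any number with $0<\epsilon_1<\operatorname{dist}(\partial G_0,\partial G_1)$. Then there exist numbers $\epsilon_2,\dots,\epsilon_m$ with $\epsilon_1>\epsilon_2>\cdots>\epsilon_m>0$ and a nilpotent square complex matrix $T$ such that $$G_0\Supset\sigma_{\epsilon_1}(T)\Supset G_1\Supset\sigma_{\epsilon_2}(T)\Supset G_2\Supset\cdots\Supset G_{m-1}\Supset\sigma_{\epsilon_m}(T)\Supset G_m.$$
   Context: For sets $A,G\subset\mathbb C$, $G\Supset A$ means $G\supset\overline{A}$ (closure of $A$). For a matrix $T$ (with operator norm induced by the Euclidean norm) and $\epsilon>0$, the $\epsilon$-pseudospectrum is $\sigma_\epsilon(T)=\{z\in\mathbb C:\Psi_T(z)<\epsilon\}$, where $\Psi_T(z)=0$ for $z\in\sigma(T)$ and $\Psi_T(z)=\|(T-z)^{-1}\|^{-1}$ otherwise. *)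

theory Defs
  imports "HOL-Analysis.Analysis" "Jordan_Normal_Form.Char_Poly"
    "Jordan_Normal_Form.Gauss_Jordan_Elimination"
begin

definition vec_norm2 :: "complex Matrix.vec \<Rightarrow> real" where
  "vec_norm2 v = sqrt (\<Sum>i<dim_vec v. (cmod (vec_index v i))\<^sup>2)"

definition op_norm2 :: "complex Matrix.mat \<Rightarrow> real" where
  "op_norm2 A = Sup {vec_norm2 (A *\<^sub>v v) | v. v \<in> carrier_vec (dim_col A) \<and> vec_norm2 v \<le> 1}"

definition mat_spectrum :: "complex Matrix.mat \<Rightarrow> complex set" where
  "mat_spectrum T = {z. eigenvalue T z}"

definition Psi :: "complex Matrix.mat \<Rightarrow> complex \<Rightarrow> real" where
  "Psi T z = (if z \<in> mat_spectrum T then 0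
     else inverse (op_norm2 (the (mat_inverse (T - z \<cdot>\<^sub>m 1\<^sub>m (dim_row T))))))"

definition pseudospectrum :: "real \<Rightarrow> complex Matrix.mat \<Rightarrow> complex set" where
  "pseudospectrum \<epsilon> T = {z. Psi T z < \<epsilon>}"

definition cc_in :: "complex set \<Rightarrow> complex set \<Rightarrow> bool" where
  "cc_in A G \<longleftrightarrow> closure A \<subseteq> G"

definition nilpotent_mat :: "complex Matrix.mat \<Rightarrow> bool" where
  "nilpotent_mat T \<longleftrightarrow> (\<exists>k. T ^\<^sub>m k = 0\<^sub>m (dim_row T) (dim_col T))"

end

theory Submission
  imports Defs "HOL-Complex_Analysis.Complex_Analysis"
begin

text \<open>
  For a polynomial \<open>p\<close> with \<open>p(0) = 0\<close> let \<open>p(J)\<close> be \<open>p\<close> evaluated at the nilpotent \<open>n \<times> n\<close> shift.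
  Applying von Neumann's inequality to \<open>1 / (p - z)\<close> gives \<open>Psi (p(J)) z \<ge> dist(z, p(D))\<close> for the
  closed unit disc \<open>D\<close>, whereas \<open>p(1)\<close> becomes an approximate eigenvalue as \<open>n\<close> grows. Every point \<open>q\<close>
  of a connected open set \<open>U\<close> containing \<open>0\<close> is \<open>p(1)\<close> for some \<open>p\<close> with \<open>p(0) = 0\<close> and \<open>p(D) \<subseteq> U\<close>.
  Letting \<open>q\<close> range over a finite net, a direct sum of such blocks is a nilpotent matrix \<open>T\<close> with
  \<open>Psi T z \<ge> dist(z, U)\<close> everywhere and \<open>Psi T < \<epsilon>\<close> on a given compact subset of \<open>U\<close>. With \<open>U\<close> a small
  neighbourhood of \<open>G k\<close> this settles one level. The levels are combined by a further direct sum,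
  which takes unions of pseudospectra: \<open>\<epsilon> (k + 1)\<close> is chosen so small that the pseudospectrum of
  the earlier (nilpotent) blocks has shrunk to a neighbourhood of \<open>0\<close>.
\<close>

section \<open>Coefficient bounds for products of power series\<close>

text \<open>The summand is \<open>x ^ k\<close> for an \<open>M\<close>-th root of unity
  \<open>x\<close>, so the sum is geometric and vanishes unless \<open>x = 1\<close>.\<close>

lemma sum_roots_unity_orthogonal:
  assumes "i < M" "j < M"
  shows "(\<Sum>k<M. cis (2 * pi * real k / real M) ^ i * cnj (cis (2 * pi * real k / real M)) ^ j)
         = (if i = j then of_nat M else (0 :: complex))"
proof -
  define x where "x = cis (2 * pi * (real i - real j) / real M)"
  have M: "M > 0" using assms by simp
  have "cis (2 * pi * real k / real M) ^ i * cnj (cis (2 * pi * real k / real M)) ^ j = x ^ k" for k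
    by (simp add: x_def cis_cnj Complex.DeMoivre cis_mult field_simps diff_divide_distrib)
  hence eq: "(\<Sum>k<M. cis (2 * pi * real k / real M) ^ i * cnj (cis (2 * pi * real k / real M)) ^ j)
         = (\<Sum>k<M. x ^ k)" by simp
  show ?thesis
  proof (cases "i = j")
    case True
    thus ?thesis unfolding eq by (simp add: x_def)
  next
    case False
    have "x ^ M = cis (2 * pi * of_int (int i - int j))"
      using M by (simp add: x_def Complex.DeMoivre)
    also have "\<dots> = 1" by (rule cis_multiple_2pi) auto
    finally have "x ^ M = 1" .
    \<comment> \<open>\<open>x = 1\<close> would make \<open>M\<close> divide the nonzero number
      \<open>i - j\<close>, whose modulus is below \<open>M\<close>.\<close>
    moreover have "x \<noteq> 1"
    proof
      assume "x = 1"
      hence "cos (2 * pi * (real i - real j) / real M) = 1"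
        by (metis x_def cis.sel(1) one_complex.sel(1))
      then obtain n :: int where "2 * pi * (real i - real j) / real M = real_of_int n * 2 * pi"
        using cos_one_2pi_int by blast
      hence "2 * pi * (real i - real j) = 2 * pi * (real_of_int n * real M)" using M by (simp add: field_simps)
      hence "real i - real j = real_of_int n * real M" by (simp only: mult_cancel_left) simp
      hence n: "int i - int j = n * int M"
        by (metis of_int_diff of_int_eq_iff of_int_mult of_int_of_nat_eq)
      have "\<bar>n\<bar> * int M = \<bar>int i - int j\<bar>" by (simp add: n abs_mult)
      also have "\<dots> < 1 * int M" using assms by linarith
      finally have "n = 0" using M by (simp add: mult_less_cancel_right)
      with n False show False by simp
    qed
    ultimately show ?thesis unfolding eq using False by (simp add: geometric_sum)
  qed
qed

text \<open>Discrete Parseval identity: sampling at the \<open>M\<close>-th roots of unity replaces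
  integration over the circle, and \<open>M\<close> exceeding the degree rules out aliasing.\<close>

lemma parseval_poly:
  fixes p :: "complex poly"
  assumes "degree p < M"
  shows "(\<Sum>k<M. (cmod (poly p (cis (2 * pi * real k / real M))))\<^sup>2)
         = real M * (\<Sum>i<M. (cmod (coeff p i))\<^sup>2)"
proof -
  define w where "w k = cis (2 * pi * real k / real M)" for k :: nat
  have P: "poly p z = (\<Sum>i<M. coeff p i * z ^ i)" for z
  proof -
    have "poly p z = (\<Sum>i\<le>degree p. coeff p i * z ^ i)" by (simp add: poly_altdef)
    also have "\<dots> = (\<Sum>i<M. coeff p i * z ^ i)"
      by (rule sum.mono_neutral_left) (use assms in \<open>auto simp: coeff_eq_0\<close>)
    finally show ?thesis .
  qed
  have "complex_of_real (\<Sum>k<M. (cmod (poly p (w k)))\<^sup>2) = (\<Sum>k<M. poly p (w k) * cnj (poly p (w k)))"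
    by (simp only: of_real_sum complex_norm_square)
  also have "\<dots> = (\<Sum>k<M. \<Sum>i<M. \<Sum>j<M. (coeff p i * cnj (coeff p j)) * (w k ^ i * cnj (w k) ^ j))"
    unfolding P by (simp add: sum_product algebra_simps)
  also have "\<dots> = (\<Sum>i<M. \<Sum>j<M. \<Sum>k<M. (coeff p i * cnj (coeff p j)) * (w k ^ i * cnj (w k) ^ j))"
  proof -
    have "(\<Sum>k<M. \<Sum>i<M. \<Sum>j<M. F i j k) = (\<Sum>i<M. \<Sum>j<M. \<Sum>k<M. F i j k)" for F :: "nat \<Rightarrow> nat \<Rightarrow> nat \<Rightarrow> complex"
      by (subst sum.swap) (rule sum.cong[OF refl], rule sum.swap)
    thus ?thesis .
  qed
  also have "\<dots> = (\<Sum>i<M. \<Sum>j<M. (coeff p i * cnj (coeff p j)) * (if i = j then of_nat M else 0))"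
    unfolding sum_distrib_left[symmetric]
    by (intro sum.cong refl arg_cong2[of _ _ _ _ "(*)"]) 
       (use sum_roots_unity_orthogonal[of _ M] in \<open>auto simp: w_def\<close>)
  also have "\<dots> = (\<Sum>i<M. \<Sum>j<M. if i = j then coeff p i * cnj (coeff p j) * of_nat M else 0)"
    by (intro sum.cong) auto
  also have "\<dots> = (\<Sum>i<M. coeff p i * cnj (coeff p i) * of_nat M)"
    by (simp add: sum.delta)
  also have "\<dots> = complex_of_real (real M * (\<Sum>i<M. (cmod (coeff p i))\<^sup>2))"
    by (simp only: complex_norm_square of_real_mult of_real_sum sum_distrib_left of_real_of_nat_eq mult_ac)
  finally show ?thesis unfolding w_def of_real_eq_iff .
qed

text \<open>On the circle \<open>h\<close> enlarges \<open>u\<close> by at most the factor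
  \<open>C\<close>, and Parseval carries this pointwise bound over to the coefficients. Dropping the
  coefficients of \<open>h * u\<close> from \<open>n\<close> on only decreases the left
  side.\<close>

lemma poly_mult_coeffs_l2_bound:
  fixes h u :: "complex poly"
  assumes "\<And>z. cmod z = 1 \<Longrightarrow> cmod (poly h z) \<le> C" and "degree u < n"
  shows "(\<Sum>i<n. (cmod (coeff (h * u) i))\<^sup>2) \<le> C\<^sup>2 * (\<Sum>i<n. (cmod (coeff u i))\<^sup>2)"
proof -
  \<comment> \<open>\<open>M\<close> exceeds the degrees of both \<open>h * u\<close> and
    \<open>u\<close>, so the same sample points serve both.\<close>
  define M where "M = Suc (degree (h * u)) + n"
  define w where "w k = cis (2 * pi * real k / real M)" for k :: nat
  have deg: "degree (h * u) < M" "degree u < M" and M: "M > 0" "n \<le> M"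
    using assms(2) by (auto simp: M_def)
  have "real M * (\<Sum>i<n. (cmod (coeff (h * u) i))\<^sup>2) \<le> real M * (\<Sum>i<M. (cmod (coeff (h * u) i))\<^sup>2)"
    using M by (intro mult_left_mono sum_mono2) auto
  also have "\<dots> = (\<Sum>k<M. (cmod (poly (h * u) (w k)))\<^sup>2)"
    using parseval_poly[OF deg(1)] by (simp add: w_def)
  also have "\<dots> \<le> (\<Sum>k<M. C\<^sup>2 * (cmod (poly u (w k)))\<^sup>2)"
  proof (rule sum_mono)
    fix k
    have "cmod (poly h (w k)) \<le> C" by (rule assms(1)) (simp add: w_def)
    thus "(cmod (poly (h * u) (w k)))\<^sup>2 \<le> C\<^sup>2 * (cmod (poly u (w k)))\<^sup>2"
      by (simp add: norm_mult power_mult_distrib mult_right_mono power_mono)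
  qed
  also have "\<dots> = C\<^sup>2 * (real M * (\<Sum>i<M. (cmod (coeff u i))\<^sup>2))"
    using parseval_poly[OF deg(2)] by (simp add: w_def flip: sum_distrib_left)
  also have "(\<Sum>i<M. (cmod (coeff u i))\<^sup>2) = (\<Sum>i<n. (cmod (coeff u i))\<^sup>2)"
    by (rule sum.mono_neutral_right) (use M assms(2) in \<open>auto simp: coeff_eq_0\<close>)
  finally show ?thesis using M by (simp add: mult.left_commute)
qed

text \<open>Only the first \<open>n\<close> coefficients of \<open>f\<close> matter, so
  \<open>f\<close> may be replaced by a long truncation, which is uniformly close to
  \<open>f\<close> on the circle; this reduces to polynomials. The outcome is von Neumann's
  inequality for the nilpotent shift.\<close>

lemma fps_mult_coeffs_l2_bound:
  fixes f u :: "complex fps"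
  assumes rad: "fps_conv_radius f > 1"
    and bd: "\<And>z. cmod z = 1 \<Longrightarrow> cmod (eval_fps f z) \<le> C"
  shows "(\<Sum>i<n. (cmod (fps_nth (f * u) i))\<^sup>2) \<le> C\<^sup>2 * (\<Sum>i<n. (cmod (fps_nth u i))\<^sup>2)"
proof (cases "n = 0")
  case False
  define v where "v = truncate_fps n u"
  define S where "S = (\<Sum>i<n. (cmod (fps_nth u i))\<^sup>2)"
  have cv: "coeff v i = (if i < n then fps_nth u i else 0)" for i
    by (simp add: v_def coeff_truncate_fps)
  have dv: "degree v < n"
    using False by (simp add: v_def degree_truncate_fps)
  \<comment> \<open>A radius of convergence beyond 1 gives absolute convergence at 1, hence a tail
    bound that is uniform over the circle.\<close>
  have sm: "summable (\<lambda>k. cmod (fps_nth f k))"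
  proof -
    obtain r where r: "1 < ereal r" "ereal r < fps_conv_radius f"
      using ereal_dense2[OF rad] by auto
    hence "ereal (norm (complex_of_real r)) < fps_conv_radius f" by simp
    from summable_fps[OF this] show ?thesis
      using powser_insidea[of "fps_nth f" "complex_of_real r" 1] r by simp
  qed
  have "(\<Sum>i<n. (cmod (fps_nth (f * u) i))\<^sup>2) \<le> (C + e)\<^sup>2 * S" if e: "e > 0" for e
  proof -
    from suminf_exist_split[OF e sm] obtain N0 where
      N0: "\<And>N. N \<ge> N0 \<Longrightarrow> norm (\<Sum>k. cmod (fps_nth f (k + N))) < e" by blast
    \<comment> \<open>\<open>N \<ge> n\<close> preserves the first \<open>n\<close> coefficients of
      the product; \<open>N \<ge> N0\<close> makes the tail smaller than \<open>e\<close>.\<close>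
    define N where "N = max n N0"
    define h where "h = truncate_fps N f"
    have ch: "coeff h i = (if i < N then fps_nth f i else 0)" for i
      by (simp add: h_def coeff_truncate_fps)
    have hb: "cmod (poly h z) \<le> C + e" if z: "cmod z = 1" for z
    proof -
      have sz: "summable (\<lambda>k. fps_nth f k * z ^ k)"
        by (rule summable_norm_cancel) (use sm z in \<open>simp add: norm_mult norm_power\<close>)
      have ph: "poly h z = (\<Sum>k<N. fps_nth f k * z ^ k)"
      proof -
        have "poly h z = (\<Sum>i\<le>degree h. coeff h i * z ^ i)" by (simp add: poly_altdef)
        also have "\<dots> = (\<Sum>i<N. coeff h i * z ^ i)"
        proof (rule sum.mono_neutral_cong)
          show "coeff h i * z ^ i = 0" if "i \<in> {..degree h} - {..<N}" for i using that by (simp add: ch)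
          show "coeff h i * z ^ i = 0" if "i \<in> {..<N} - {..degree h}" for i using that by (simp add: coeff_eq_0)
        qed auto
        finally show ?thesis by (simp add: ch)
      qed
      have "eval_fps f z = (\<Sum>k. fps_nth f (k + N) * z ^ (k + N)) + poly h z"
        unfolding eval_fps_def ph by (rule suminf_split_initial_segment[OF sz])
      hence "cmod (poly h z) \<le> cmod (eval_fps f z) + cmod (\<Sum>k. fps_nth f (k + N) * z ^ (k + N))"
        by (metis add_diff_cancel_left' norm_triangle_ineq4)
      also have "cmod (\<Sum>k. fps_nth f (k + N) * z ^ (k + N)) \<le> (\<Sum>k. cmod (fps_nth f (k + N) * z ^ (k + N)))"
        by (rule summable_norm) (use summable_ignore_initial_segment[OF sm, of N] z in \<open>simp add: norm_mult norm_power\<close>)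
      also have "\<dots> = (\<Sum>k. cmod (fps_nth f (k + N)))" using z by (simp add: norm_mult norm_power)
      also have "\<dots> < e" using N0[of N] by (simp add: N_def)
      also have "cmod (eval_fps f z) \<le> C" by (rule bd[OF z])
      finally show ?thesis by simp
    qed
    have "fps_nth (f * u) i = coeff (h * v) i" if "i < n" for i
      unfolding fps_mult_nth coeff_mult atLeast0AtMost
      by (intro sum.cong refl) (use that in \<open>auto simp: ch cv N_def\<close>)
    hence "(\<Sum>i<n. (cmod (fps_nth (f * u) i))\<^sup>2) = (\<Sum>i<n. (cmod (coeff (h * v) i))\<^sup>2)" by simp
    also have "\<dots> \<le> (C + e)\<^sup>2 * (\<Sum>i<n. (cmod (coeff v i))\<^sup>2)"
      by (rule poly_mult_coeffs_l2_bound[OF hb dv])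
    finally show ?thesis by (simp add: cv S_def)
  qed
  \<comment> \<open>The left side does not depend on \<open>e\<close>, so the bound survives letting
    \<open>e\<close> tend to 0.\<close>
  moreover have "((\<lambda>e. (C + e)\<^sup>2 * S) \<longlongrightarrow> (C + 0)\<^sup>2 * S) (at_right 0)"
    by (intro tendsto_intros)
  ultimately have "(\<Sum>i<n. (cmod (fps_nth (f * u) i))\<^sup>2) \<le> (C + 0)\<^sup>2 * S"
    by (intro tendsto_lowerbound[where F = "at_right 0"]) (auto simp: eventually_at_right_less eventually_at_filter)
  thus ?thesis by (simp add: S_def)
qed simp

section \<open>The resolvent of a complex matrix\<close>

lemma vec_norm2_eq_L2_set: "vec_norm2 v = L2_set (\<lambda>i. cmod (vec_index v i)) {..<dim_vec v}"
  by (simp add: vec_norm2_def L2_set_def)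

lemma vec_norm2_nonneg [simp]: "0 \<le> vec_norm2 v"
  by (simp add: vec_norm2_def sum_nonneg)

lemma vec_norm2_zero [simp]: "vec_norm2 (0\<^sub>v n) = 0"
  by (simp add: vec_norm2_def)

lemma vec_norm2_eq_0_iff:
  assumes "v \<in> carrier_vec n"
  shows "vec_norm2 v = 0 \<longleftrightarrow> v = 0\<^sub>v n"
  using assms by (auto simp: vec_norm2_eq_L2_set L2_set_eq_0_iff)

lemma vec_norm2_smult: "vec_norm2 (c \<cdot>\<^sub>v v) = cmod c * vec_norm2 v"
  by (auto simp: vec_norm2_eq_L2_set L2_set_right_distrib norm_mult intro!: L2_set_cong)

lemma vec_norm2_triangle:
  assumes "v \<in> carrier_vec n" "w \<in> carrier_vec n"
  shows "vec_norm2 (v + w) \<le> vec_norm2 v + vec_norm2 w"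
proof -
  have "vec_norm2 (v + w) \<le> L2_set (\<lambda>i. cmod (vec_index v i) + cmod (vec_index w i)) {..<n}"
    using assms unfolding vec_norm2_eq_L2_set by (auto intro!: L2_set_mono norm_triangle_ineq)
  also have "\<dots> \<le> vec_norm2 v + vec_norm2 w"
    using assms L2_set_triangle_ineq[of _ _ "{..<n}"] by (simp add: vec_norm2_eq_L2_set)
  finally show ?thesis .
qed

lemma vec_norm2_triangle_minus:
  assumes "v \<in> carrier_vec n" "w \<in> carrier_vec n"
  shows "vec_norm2 (v - w) \<le> vec_norm2 v + vec_norm2 w"
proof -
  have "v - w = v + (-1) \<cdot>\<^sub>v w" using assms by (intro eq_vecI) auto
  thus ?thesis using vec_norm2_triangle[OF assms(1), of "(-1) \<cdot>\<^sub>v w"] assms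
    by (simp add: vec_norm2_smult)
qed

lemma vec_norm2_append: "(vec_norm2 (v @\<^sub>v w))\<^sup>2 = (vec_norm2 v)\<^sup>2 + (vec_norm2 w)\<^sup>2"
proof -
  let ?f = "\<lambda>i. (cmod (vec_index (v @\<^sub>v w) i))\<^sup>2"
  have "(\<Sum>i<dim_vec v + dim_vec w. ?f i) = (\<Sum>i<dim_vec v. ?f i) + (\<Sum>i<dim_vec w. ?f (dim_vec v + i))"
    by (simp add: lessThan_atLeast0 sum.atLeastLessThan_shift_0[of _ "dim_vec v"]
      flip: sum.atLeastLessThan_concat[of 0 "dim_vec v" "dim_vec v + dim_vec w"])
  thus ?thesis by (simp add: vec_norm2_def sum_nonneg)
qed

text \<open>The sum of the moduli of all entries is a crude bound, but it shows that the
  \<open>Sup\<close> in \<open>op_norm2\<close> is taken over a bounded set. It also controls the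
  powers of a nilpotent matrix later.\<close>

lemma mult_mat_vec_bounded:
  fixes A :: "complex Matrix.mat"
  obtains C where "C \<ge> 0"
    "\<And>v. v \<in> carrier_vec (dim_col A) \<Longrightarrow> vec_norm2 (A *\<^sub>v v) \<le> C * vec_norm2 v"
proof
  let ?C = "\<Sum>i<dim_row A. \<Sum>j<dim_col A. cmod (A $$ (i, j))"
  show "?C \<ge> 0" by (intro sum_nonneg) auto
  fix v :: "complex Matrix.vec" assume v: "v \<in> carrier_vec (dim_col A)"
  have vj: "cmod (vec_index v j) \<le> vec_norm2 v" if "j < dim_col A" for j
    unfolding vec_norm2_eq_L2_set by (rule member_le_L2_set) (use that v in auto)
  have "vec_norm2 (A *\<^sub>v v) \<le> (\<Sum>i<dim_row A. cmod (vec_index (A *\<^sub>v v) i))"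
    unfolding vec_norm2_eq_L2_set by (simp del: index_mult_mat_vec) (rule L2_set_le_sum, simp)
  also have "\<dots> \<le> (\<Sum>i<dim_row A. \<Sum>j<dim_col A. cmod (A $$ (i, j)) * vec_norm2 v)"
  proof (rule sum_mono)
    fix i assume i: "i \<in> {..<dim_row A}"
    have "vec_index (A *\<^sub>v v) i = (\<Sum>j<dim_col A. A $$ (i, j) * vec_index v j)"
      using i v by (simp add: scalar_prod_def atLeast0LessThan)
    also have "cmod \<dots> \<le> (\<Sum>j<dim_col A. cmod (A $$ (i, j)) * vec_norm2 v)"
      by (rule sum_norm_le) (simp add: norm_mult mult_left_mono vj)
    finally show "cmod (vec_index (A *\<^sub>v v) i) \<le> \<dots>" .
  qed
  finally show "vec_norm2 (A *\<^sub>v v) \<le> ?C * vec_norm2 v" by (simp add: sum_distrib_right)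
qed

lemma op_norm2_nonneg: "0 \<le> op_norm2 A"
  and vec_norm2_mult_le_op_norm2:
    "v \<in> carrier_vec (dim_col A) \<Longrightarrow> vec_norm2 (A *\<^sub>v v) \<le> op_norm2 A * vec_norm2 v"
proof -
  let ?S = "{vec_norm2 (A *\<^sub>v v) | v. v \<in> carrier_vec (dim_col A) \<and> vec_norm2 v \<le> 1}"
  obtain C where C: "C \<ge> 0"
    "\<And>v. v \<in> carrier_vec (dim_col A) \<Longrightarrow> vec_norm2 (A *\<^sub>v v) \<le> C * vec_norm2 v"
    using mult_mat_vec_bounded[of A] by blast
  have bdd: "bdd_above ?S"
  proof (rule bdd_aboveI)
    fix x assume "x \<in> ?S"
    then obtain v where "x = vec_norm2 (A *\<^sub>v v)" "v \<in> carrier_vec (dim_col A)" "vec_norm2 v \<le> 1" by auto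
    thus "x \<le> C * 1" using C(2)[of v] C(1) mult_left_mono[of "vec_norm2 v" 1 C] by linarith
  qed
  have up: "vec_norm2 (A *\<^sub>v v) \<le> op_norm2 A" if "v \<in> carrier_vec (dim_col A)" "vec_norm2 v \<le> 1" for v
    unfolding op_norm2_def by (rule cSup_upper[OF _ bdd]) (use that in auto)
  show "0 \<le> op_norm2 A"
    by (rule order_trans[OF vec_norm2_nonneg up[of "0\<^sub>v (dim_col A)"]]) simp_all
  assume v: "v \<in> carrier_vec (dim_col A)"
  show "vec_norm2 (A *\<^sub>v v) \<le> op_norm2 A * vec_norm2 v"
  proof (cases "vec_norm2 v = 0")
    case True
    thus ?thesis using C(2)[OF v] by simp
  next
    case False
    hence pos: "vec_norm2 v > 0" using vec_norm2_nonneg[of v] by linarith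
    define u where "u = complex_of_real (1 / vec_norm2 v) \<cdot>\<^sub>v v"
    have u: "u \<in> carrier_vec (dim_col A)" "vec_norm2 u \<le> 1"
      using v pos by (auto simp: u_def vec_norm2_smult norm_divide)
    have "A *\<^sub>v u = complex_of_real (1 / vec_norm2 v) \<cdot>\<^sub>v (A *\<^sub>v v)"
      unfolding u_def using v by (intro mult_mat_vec) auto
    hence "vec_norm2 (A *\<^sub>v u) = vec_norm2 (A *\<^sub>v v) / vec_norm2 v"
      using pos by (simp add: vec_norm2_smult norm_divide)
    thus ?thesis using up[OF u] pos by (simp add: pos_divide_le_eq)
  qed
qed

lemma op_norm2_le:
  assumes "\<And>v. v \<in> carrier_vec (dim_col A) \<Longrightarrow> vec_norm2 (A *\<^sub>v v) \<le> C * vec_norm2 v" "C \<ge> 0"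
  shows "op_norm2 A \<le> C"
  unfolding op_norm2_def
proof (rule cSup_least)
  show "{vec_norm2 (A *\<^sub>v v) | v. v \<in> carrier_vec (dim_col A) \<and> vec_norm2 v \<le> 1} \<noteq> {}"
    by (auto intro!: exI[of _ "0\<^sub>v (dim_col A)"])
  fix x assume "x \<in> {vec_norm2 (A *\<^sub>v v) | v. v \<in> carrier_vec (dim_col A) \<and> vec_norm2 v \<le> 1}"
  then obtain v where v: "x = vec_norm2 (A *\<^sub>v v)" "v \<in> carrier_vec (dim_col A)" "vec_norm2 v \<le> 1" by auto
  show "x \<le> C" using assms(1)[OF v(2)] v(1,3) mult_left_mono[OF v(3) assms(2)] by simp
qed

text \<open>\<open>Psi T z\<close> is the smallest singular value of \<open>T - z\<close>; phrasing
  this through vectors removes inverses and the eigenvalue case from all later estimates. For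
  \<open>n = 0\<close> the right side would hold for every \<open>d\<close>, hence
  \<open>n > 0\<close>.\<close>

lemma le_Psi_iff:
  assumes T: "T \<in> carrier_mat n n" and n: "n > 0"
  shows "d \<le> Psi T z \<longleftrightarrow>
    (\<forall>v\<in>carrier_vec n. d * vec_norm2 v \<le> vec_norm2 ((T - z \<cdot>\<^sub>m 1\<^sub>m n) *\<^sub>v v))"
proof -
  define A where "A = T - z \<cdot>\<^sub>m 1\<^sub>m n"
  have A: "A \<in> carrier_mat n n" unfolding A_def by (intro minus_carrier_mat) simp
  have cm: "char_matrix T z = A" using T by (auto simp: char_matrix_def A_def intro!: eq_matI)
  have triv: "d * vec_norm2 v \<le> vec_norm2 w" if "d \<le> 0" for v w :: "complex Matrix.vec"
    using that by (meson mult_nonpos_nonneg order_trans vec_norm2_nonneg)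
  show ?thesis
  proof (cases "eigenvalue T z")
    case True
    hence Psi: "Psi T z = 0" by (simp add: Psi_def mat_spectrum_def)
    from True obtain v where "eigenvector T v z" unfolding eigenvalue_def by auto
    hence v: "v \<in> carrier_vec n" "v \<noteq> 0\<^sub>v n" "A *\<^sub>v v = 0\<^sub>v n"
      unfolding eigenvector_char_matrix[OF T] cm by auto
    hence "vec_norm2 v > 0" using vec_norm2_eq_0_iff[OF v(1)] vec_norm2_nonneg[of v] by linarith
    hence "d \<le> 0" if "d * vec_norm2 v \<le> vec_norm2 (A *\<^sub>v v)"
      using that v(3) by (simp add: mult_le_0_iff)
    thus ?thesis using triv v(1) unfolding A_def[symmetric] Psi by blast
  next
    case False
    hence "det A \<noteq> 0" using eigenvalue_det[OF T] cm by simp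
    hence "A \<in> Units (ring_mat TYPE(complex) n ())" by (rule det_non_zero_imp_unit[OF A])
    then obtain B where mB: "mat_inverse A = Some B" using mat_inverse(1)[OF A, where b = "()"] by (cases "mat_inverse A") auto
    hence B: "A * B = 1\<^sub>m n" "B * A = 1\<^sub>m n" "B \<in> carrier_mat n n" using mat_inverse(2)[OF A] by auto
    have Psi: "Psi T z = inverse (op_norm2 B)"
      using False T mB by (simp add: Psi_def mat_spectrum_def A_def)
    have AB: "A *\<^sub>v (B *\<^sub>v w) = w" if "w \<in> carrier_vec n" for w
      using assoc_mult_mat_vec[OF A B(3) that] B(1) that by simp
    have BA: "B *\<^sub>v (A *\<^sub>v w) = w" if "w \<in> carrier_vec n" for w
      using assoc_mult_mat_vec[OF B(3) A that] B(2) that by simp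
    have le: "vec_norm2 v \<le> op_norm2 B * vec_norm2 (A *\<^sub>v v)" if "v \<in> carrier_vec n" for v
      using vec_norm2_mult_le_op_norm2[of "A *\<^sub>v v" B] BA[OF that] A B(3) that by auto
    \<comment> \<open>If the inverse had norm 0, \<open>le\<close> would make a unit vector vanish;
      such a vector exists because \<open>n > 0\<close>.\<close>
    have "op_norm2 B \<noteq> 0"
    proof
      assume "op_norm2 B = 0"
      hence "vec_norm2 (unit_vec n 0 :: complex Matrix.vec) = 0" 
        using le[of "unit_vec n 0"] vec_norm2_nonneg[of "unit_vec n 0"] by simp
      hence "unit_vec n 0 = (0\<^sub>v n :: complex Matrix.vec)" by (subst (asm) vec_norm2_eq_0_iff[of _ n]) auto
      thus False using n by (metis index_unit_vec(1) index_zero_vec(1) zero_neq_one)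
    qed
    hence op: "op_norm2 B > 0" using op_norm2_nonneg[of B] by linarith
    show ?thesis
    proof (cases "d \<le> 0")
      case True
      thus ?thesis using triv op Psi by (auto simp: A_def intro: order_trans[of d 0])
    next
      case False
      show ?thesis unfolding A_def[symmetric]
      proof safe
        fix v :: "complex Matrix.vec" assume "d \<le> Psi T z" and v: "v \<in> carrier_vec n"
        hence "d * op_norm2 B \<le> 1" using op by (simp add: Psi field_simps)
        hence "(d * op_norm2 B) * vec_norm2 (A *\<^sub>v v) \<le> 1 * vec_norm2 (A *\<^sub>v v)"
          by (rule mult_right_mono) simp
        moreover have "d * vec_norm2 v \<le> d * (op_norm2 B * vec_norm2 (A *\<^sub>v v))"
          using False le[OF v] by (intro mult_left_mono) auto
        ultimately show "d * vec_norm2 v \<le> vec_norm2 (A *\<^sub>v v)" by (simp add: mult.assoc)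
      next
        assume *: "\<forall>v\<in>carrier_vec n. d * vec_norm2 v \<le> vec_norm2 (A *\<^sub>v v)"
        have "op_norm2 B \<le> 1 / d"
        proof (rule op_norm2_le)
          fix w :: "complex Matrix.vec" assume "w \<in> carrier_vec (dim_col B)"
          hence w: "w \<in> carrier_vec n" using B(3) by auto
          have "d * vec_norm2 (B *\<^sub>v w) \<le> vec_norm2 w"
            using *[rule_format, of "B *\<^sub>v w"] AB[OF w] B(3) w by auto
          thus "vec_norm2 (B *\<^sub>v w) \<le> 1 / d * vec_norm2 w" using False by (simp add: field_simps)
        qed (use False in simp)
        thus "d \<le> Psi T z" using op False by (simp add: Psi field_simps)
      qed
    qed
  qed
qed

lemma Psi_nonneg:
  assumes "T \<in> carrier_mat n n" "n > 0"
  shows "0 \<le> Psi T z"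
  by (simp add: le_Psi_iff[OF assms])

text \<open>Upper bounds on \<open>Psi\<close> come from a single approximate eigenvector
  \<open>v\<close>.\<close>

lemma Psi_le:
  assumes T: "T \<in> carrier_mat n n" "n > 0" and v: "v \<in> carrier_vec n" "vec_norm2 v > 0"
    and "vec_norm2 ((T - z \<cdot>\<^sub>m 1\<^sub>m n) *\<^sub>v v) \<le> c * vec_norm2 v"
  shows "Psi T z \<le> c"
proof -
  have "Psi T z * vec_norm2 v \<le> c * vec_norm2 v"
    using le_Psi_iff[OF T, of "Psi T z" z] v(1) assms(5) by (meson order_refl order_trans)
  thus ?thesis using v(2) by simp
qed

section \<open>Direct sums and nilpotent matrices\<close>

definition direct_sum :: "complex Matrix.mat \<Rightarrow> complex Matrix.mat \<Rightarrow> complex Matrix.mat" where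
  "direct_sum A B = four_block_mat A (0\<^sub>m (dim_row A) (dim_col B)) (0\<^sub>m (dim_row B) (dim_col A)) B"

lemma direct_sum_carrier:
  "A \<in> carrier_mat n n \<Longrightarrow> B \<in> carrier_mat m m \<Longrightarrow> direct_sum A B \<in> carrier_mat (n + m) (n + m)"
  by (auto simp: direct_sum_def)

text \<open>Padding with zeros embeds the vectors of each summand, which gives the upper bounds;
  Pythagoras on the two components gives the lower bound.\<close>

lemma Psi_direct_sum:
  assumes A: "A \<in> carrier_mat n n" "n > 0" and B: "B \<in> carrier_mat m m" "m > 0"
  shows "Psi (direct_sum A B) z = min (Psi A z) (Psi B z)"
proof -
  let ?T = "direct_sum A B"
  have T: "?T \<in> carrier_mat (n + m) (n + m)" "n + m > 0" using direct_sum_carrier A B by auto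
  have eq: "?T - z \<cdot>\<^sub>m 1\<^sub>m (n + m) = four_block_mat (A - z \<cdot>\<^sub>m 1\<^sub>m n) (0\<^sub>m n m) (0\<^sub>m m n) (B - z \<cdot>\<^sub>m 1\<^sub>m m)"
    using A B by (auto simp: direct_sum_def intro!: eq_matI)
  have app: "(?T - z \<cdot>\<^sub>m 1\<^sub>m (n + m)) *\<^sub>v (a @\<^sub>v b) = ((A - z \<cdot>\<^sub>m 1\<^sub>m n) *\<^sub>v a) @\<^sub>v ((B - z \<cdot>\<^sub>m 1\<^sub>m m) *\<^sub>v b)"
    if "a \<in> carrier_vec n" "b \<in> carrier_vec m" for a b
    unfolding eq by (rule mult_mat_vec_split) (use A B that in auto)
  have n0: "vec_norm2 (a @\<^sub>v 0\<^sub>v k) = vec_norm2 a" "vec_norm2 (0\<^sub>v k @\<^sub>v a) = vec_norm2 a" for a k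
    by (rule power2_eq_imp_eq; simp add: vec_norm2_append)+
  note lT = le_Psi_iff[OF T, of _ z] and lA = le_Psi_iff[OF A, of _ z] and lB = le_Psi_iff[OF B, of _ z]
  have "Psi ?T z \<le> Psi A z" unfolding lA
  proof
    fix a :: "complex Matrix.vec" assume a: "a \<in> carrier_vec n"
    have "(B - z \<cdot>\<^sub>m 1\<^sub>m m) *\<^sub>v 0\<^sub>v m = 0\<^sub>v m" using B by (auto intro!: eq_vecI simp: scalar_prod_def)
    with app[OF a, of "0\<^sub>v m"] lT[of "Psi ?T z"] a
    show "Psi ?T z * vec_norm2 a \<le> vec_norm2 ((A - z \<cdot>\<^sub>m 1\<^sub>m n) *\<^sub>v a)"
      by (metis append_carrier_vec n0(1) order_refl zero_carrier_vec)
  qed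
  moreover have "Psi ?T z \<le> Psi B z" unfolding lB
  proof
    fix b :: "complex Matrix.vec" assume b: "b \<in> carrier_vec m"
    have "(A - z \<cdot>\<^sub>m 1\<^sub>m n) *\<^sub>v 0\<^sub>v n = 0\<^sub>v n" using A by (auto intro!: eq_vecI simp: scalar_prod_def)
    with app[OF _ b, of "0\<^sub>v n"] lT[of "Psi ?T z"] b
    show "Psi ?T z * vec_norm2 b \<le> vec_norm2 ((B - z \<cdot>\<^sub>m 1\<^sub>m m) *\<^sub>v b)"
      by (metis append_carrier_vec n0(2) order_refl zero_carrier_vec)
  qed
  moreover have "min (Psi A z) (Psi B z) \<le> Psi ?T z"
  proof -
    define d where "d = min (Psi A z) (Psi B z)"
    \<comment> \<open>Non-negativity of \<open>d\<close> lets the bounds on the two components be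
      squared and added.\<close>
    have d: "d \<ge> 0" "d \<le> Psi A z" "d \<le> Psi B z" using Psi_nonneg[OF A] Psi_nonneg[OF B] by (auto simp: d_def)
    show ?thesis unfolding d_def[symmetric] lT all_vec_append
    proof safe
      fix a b :: "complex Matrix.vec" assume a: "a \<in> carrier_vec n" and b: "b \<in> carrier_vec m"
      let ?a = "(A - z \<cdot>\<^sub>m 1\<^sub>m n) *\<^sub>v a" and ?b = "(B - z \<cdot>\<^sub>m 1\<^sub>m m) *\<^sub>v b"
      have "(d * vec_norm2 a)\<^sup>2 \<le> (vec_norm2 ?a)\<^sup>2" "(d * vec_norm2 b)\<^sup>2 \<le> (vec_norm2 ?b)\<^sup>2"
        using lA lB d a b by (auto intro!: power_mono)
      hence "(d * vec_norm2 (a @\<^sub>v b))\<^sup>2 \<le> (vec_norm2 (?a @\<^sub>v ?b))\<^sup>2"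
        by (simp add: vec_norm2_append power_mult_distrib distrib_left)
      hence "d * vec_norm2 (a @\<^sub>v b) \<le> vec_norm2 (?a @\<^sub>v ?b)"
        by (rule power2_le_imp_le) simp
      thus "d * vec_norm2 (a @\<^sub>v b) \<le> vec_norm2 ((?T - z \<cdot>\<^sub>m 1\<^sub>m (n + m)) *\<^sub>v (a @\<^sub>v b))"
        by (simp add: app[OF a b])
    qed
  qed
  ultimately show ?thesis by simp
qed

lemma pow_mat_eq_0_mono:
  fixes A :: "complex Matrix.mat"
  assumes "A \<in> carrier_mat n n" "A ^\<^sub>m k = 0\<^sub>m n n"
  shows "A ^\<^sub>m (k + j) = 0\<^sub>m n n"
  using assms by (induction j) auto

lemma nilpotent_direct_sum:
  assumes A: "A \<in> carrier_mat n n" and B: "B \<in> carrier_mat m m"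
    and "nilpotent_mat A" "nilpotent_mat B"
  shows "nilpotent_mat (direct_sum A B)"
proof -
  from assms obtain k l where kl: "A ^\<^sub>m k = 0\<^sub>m n n" "B ^\<^sub>m l = 0\<^sub>m m m"
    by (auto simp: nilpotent_mat_def)
  have "A ^\<^sub>m (k + l) = 0\<^sub>m n n" "B ^\<^sub>m (k + l) = 0\<^sub>m m m"
    using pow_mat_eq_0_mono[OF A kl(1), of l] pow_mat_eq_0_mono[OF B kl(2), of k] by (simp_all add: add.commute)
  hence "direct_sum A B ^\<^sub>m (k + l) = four_block_mat (0\<^sub>m n n) (0\<^sub>m n m) (0\<^sub>m m n) (0\<^sub>m m m)"
    using A B pow_four_block_mat[OF A B, of "k + l"] by (simp add: direct_sum_def)
  also have "\<dots> = 0\<^sub>m (n + m) (n + m)" by (intro eq_matI) auto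
  finally show ?thesis using A B unfolding nilpotent_mat_def by (auto simp: direct_sum_def)
qed

text \<open>With \<open>w\<close> the image of \<open>v\<close> under \<open>T - z\<close>,
  iterating \<open>z v = T v - w\<close> is a Neumann series that stops once the power of
  \<open>T\<close> vanishes, so \<open>c\<close> depends only on \<open>T\<close> and
  \<open>r\<close>. This later confines the pseudospectrum of the old blocks to a small disc about
  0.\<close>

lemma nilpotent_Psi_bounded_below:
  assumes T: "T \<in> carrier_mat n n" "n > 0" and "nilpotent_mat T" and r: "r > 0"
  obtains c where "c > 0" "\<And>z. cmod z \<ge> r \<Longrightarrow> c \<le> Psi T z"
proof -
  from assms obtain K where K: "T ^\<^sub>m K = 0\<^sub>m n n" by (auto simp: nilpotent_mat_def)
  obtain C where C: "C \<ge> 0" "\<And>v. v \<in> carrier_vec n \<Longrightarrow> vec_norm2 (T *\<^sub>v v) \<le> C * vec_norm2 v"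
    using mult_mat_vec_bounded[of T] T by auto
  have pow: "vec_norm2 (T ^\<^sub>m k *\<^sub>v v) \<le> C ^ k * vec_norm2 v" if v: "v \<in> carrier_vec n" for k v
    using v
  proof (induction k arbitrary: v)
    case (Suc k)
    have "T ^\<^sub>m Suc k *\<^sub>v v = T ^\<^sub>m k *\<^sub>v (T *\<^sub>v v)" using T Suc.prems by (simp add: assoc_mult_mat_vec[of _ n n _ n])
    also have "vec_norm2 \<dots> \<le> C ^ k * vec_norm2 (T *\<^sub>v v)" using T Suc by auto
    also have "\<dots> \<le> C ^ k * (C * vec_norm2 v)" using C Suc.prems by (intro mult_left_mono) auto
    finally show ?case by (simp add: mult_ac)
  qed (use T in auto)
  \<comment> \<open>Norm bound for the first \<open>k\<close> terms of the Neumann series: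
    \<open>C ^ j\<close> bounds the powers of \<open>T\<close>, and \<open>r\<close> bounds
    \<open>cmod z\<close> from below.\<close>
  define S where "S k = (\<Sum>j<k. C ^ j / r ^ Suc j)" for k
  have S: "S K \<ge> 0" unfolding S_def using C r by (intro sum_nonneg) auto
  show ?thesis
  proof
    \<comment> \<open>The added 1 makes the denominator positive knowing only
      \<open>S K \<ge> 0\<close>.\<close>
    show "1 / (S K + 1) > 0" using S by simp
    fix z assume z: "cmod z \<ge> r"
    show "1 / (S K + 1) \<le> Psi T z" unfolding le_Psi_iff[OF T]
    proof
      fix v :: "complex Matrix.vec" assume v: "v \<in> carrier_vec n"
      define w where "w = (T - z \<cdot>\<^sub>m 1\<^sub>m n) *\<^sub>v v"
      have w: "w \<in> carrier_vec n" unfolding w_def using v by (intro mult_mat_vec_carrier[of _ n n] minus_carrier_mat) auto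
      have zv: "z \<cdot>\<^sub>v v = T *\<^sub>v v - w"
      proof -
        have "w = T *\<^sub>v v - (z \<cdot>\<^sub>m 1\<^sub>m n) *\<^sub>v v"
          unfolding w_def using T v by (intro minus_mult_distrib_mat_vec) auto
        also have "(z \<cdot>\<^sub>m 1\<^sub>m n) *\<^sub>v v = z \<cdot>\<^sub>v v" using v by (auto intro!: eq_vecI)
        finally show ?thesis using T v by (auto intro!: eq_vecI)
      qed
      \<comment> \<open>\<open>T ^\<^sub>m k\<close> is applied to \<open>zv\<close> and norms are
        taken, using \<open>r \<le> cmod z\<close>.\<close>
      have step: "r * vec_norm2 (T ^\<^sub>m k *\<^sub>v v) \<le> vec_norm2 (T ^\<^sub>m Suc k *\<^sub>v v) + C ^ k * vec_norm2 w" for k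
      proof -
        have Tk: "T ^\<^sub>m k \<in> carrier_mat n n" using T by simp
        have "r * vec_norm2 (T ^\<^sub>m k *\<^sub>v v) \<le> cmod z * vec_norm2 (T ^\<^sub>m k *\<^sub>v v)"
          using z by (intro mult_right_mono) auto
        also have "\<dots> = vec_norm2 (T ^\<^sub>m k *\<^sub>v (z \<cdot>\<^sub>v v))"
          using mult_mat_vec[OF Tk v, of z] by (simp add: vec_norm2_smult)
        also have "T ^\<^sub>m k *\<^sub>v (z \<cdot>\<^sub>v v) = T ^\<^sub>m k *\<^sub>v (T *\<^sub>v v) - T ^\<^sub>m k *\<^sub>v w"
          unfolding zv using T v w Tk by (intro mult_minus_distrib_mat_vec) auto
        also have "T ^\<^sub>m k *\<^sub>v (T *\<^sub>v v) = T ^\<^sub>m Suc k *\<^sub>v v"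
          using T v Tk by (simp add: assoc_mult_mat_vec[of _ n n _ n])
        also have "vec_norm2 (T ^\<^sub>m Suc k *\<^sub>v v - T ^\<^sub>m k *\<^sub>v w) \<le> vec_norm2 (T ^\<^sub>m Suc k *\<^sub>v v) + vec_norm2 (T ^\<^sub>m k *\<^sub>v w)"
          using T v w Tk by (intro vec_norm2_triangle_minus[of _ n] mult_mat_vec_carrier[of _ n n]) auto
        finally show ?thesis using pow[OF w, of k] by linarith
      qed
      have "vec_norm2 v \<le> vec_norm2 (T ^\<^sub>m k *\<^sub>v v) / r ^ k + S k * vec_norm2 w" for k
      proof (induction k)
        case 0
        show ?case using T v by (simp add: S_def)
      next
        case (Suc k)
        have "vec_norm2 (T ^\<^sub>m k *\<^sub>v v) \<le> (vec_norm2 (T ^\<^sub>m Suc k *\<^sub>v v) + C ^ k * vec_norm2 w) / r"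
          using step[of k] r by (simp add: field_simps)
        hence "vec_norm2 (T ^\<^sub>m k *\<^sub>v v) / r ^ k \<le> (vec_norm2 (T ^\<^sub>m Suc k *\<^sub>v v) + C ^ k * vec_norm2 w) / r / r ^ k"
          using r by (intro divide_right_mono) auto
        also have "\<dots> = vec_norm2 (T ^\<^sub>m Suc k *\<^sub>v v) / r ^ Suc k + C ^ k / r ^ Suc k * vec_norm2 w"
          by (simp add: add_divide_distrib mult.commute)
        finally show ?case using Suc by (simp add: S_def algebra_simps del: pow_mat.simps power_Suc)
      qed
      \<comment> \<open>At \<open>k = K\<close> the remainder term contains
        \<open>T ^\<^sub>m K *\<^sub>v v\<close>, which is zero.\<close>
      moreover have "0\<^sub>m n n *\<^sub>v v = 0\<^sub>v n" using v by (auto intro!: eq_vecI simp: scalar_prod_def)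
      ultimately have "vec_norm2 v \<le> S K * vec_norm2 w" using K by (metis add_0 div_0 vec_norm2_zero)
      also have "\<dots> \<le> (S K + 1) * vec_norm2 w" by (simp add: mult_right_mono)
      finally show "1 / (S K + 1) * vec_norm2 v \<le> vec_norm2 ((T - z \<cdot>\<^sub>m 1\<^sub>m n) *\<^sub>v v)"
        using S unfolding w_def[symmetric] by (simp add: field_simps)
    qed
  qed
qed

section \<open>Polynomials of the nilpotent shift\<close>

text \<open>The matrix of multiplication by \<open>f\<close> on power series modulo \<open>X ^ n\<close>, i.e. \<open>f\<close> applied
  to the nilpotent shift.\<close>

definition toeplitz :: "nat \<Rightarrow> complex fps \<Rightarrow> complex Matrix.mat" where
  "toeplitz n f = Matrix.mat n n (\<lambda>(i, j). if j \<le> i then fps_nth f (i - j) else 0)"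

lemma toeplitz_carrier [simp]: "toeplitz n f \<in> carrier_mat n n"
  by (simp add: toeplitz_def)

text \<open>Modulo \<open>X ^ n\<close> the product depends only on \<open>u\<close> modulo
  \<open>X ^ n\<close>, so truncation is compatible with multiplication.\<close>

lemma toeplitz_mult_vec:
  "toeplitz n f *\<^sub>v Matrix.vec n (fps_nth u) = Matrix.vec n (fps_nth (f * u))"
proof (rule eq_vecI)
  fix i assume "i < dim_vec (Matrix.vec n (fps_nth (f * u)))"
  hence i: "i < n" by simp
  have "vec_index (toeplitz n f *\<^sub>v Matrix.vec n (fps_nth u)) i
      = (\<Sum>j<n. (if j \<le> i then fps_nth f (i - j) else 0) * fps_nth u j)"
    using i by (simp add: toeplitz_def scalar_prod_def atLeast0LessThan)
  also have "\<dots> = (\<Sum>j=0..i. fps_nth u j * fps_nth f (i - j))"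
    by (rule sum.mono_neutral_cong_right) (use i in auto)
  also have "\<dots> = fps_nth (f * u) i" by (simp add: fps_mult_nth mult.commute[of f u])
  finally show "vec_index (toeplitz n f *\<^sub>v Matrix.vec n (fps_nth u)) i = vec_index (Matrix.vec n (fps_nth (f * u))) i"
    using i by simp
qed (simp add: toeplitz_def)

lemma vec_eq_fps_coeffs:
  "v \<in> carrier_vec n \<Longrightarrow> v = Matrix.vec n (fps_nth (Abs_fps (vec_index v)))"
  by (intro eq_vecI) auto

lemma vec_norm2_fps: "(vec_norm2 (Matrix.vec n (fps_nth u)))\<^sup>2 = (\<Sum>i<n. (cmod (fps_nth u i))\<^sup>2)"
  by (simp add: vec_norm2_def sum_nonneg)

lemma toeplitz_minus_smult_one:
  "toeplitz n f - z \<cdot>\<^sub>m 1\<^sub>m n = toeplitz n (f - fps_const z)"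
  by (intro eq_matI) (auto simp: toeplitz_def)

text \<open>Powers of the matrix are multiplication by powers of \<open>f\<close>, and
  \<open>f ^ n\<close> is divisible by \<open>X ^ n\<close>.\<close>

lemma nilpotent_toeplitz:
  assumes "fps_nth f 0 = 0"
  shows "nilpotent_mat (toeplitz n f)"
proof -
  have pow: "toeplitz n f ^\<^sub>m k *\<^sub>v Matrix.vec n (fps_nth u) = Matrix.vec n (fps_nth (f ^ k * u))" for k u
  proof (induction k arbitrary: u)
    case (Suc k)
    have "toeplitz n f ^\<^sub>m Suc k *\<^sub>v Matrix.vec n (fps_nth u)
        = toeplitz n f ^\<^sub>m k *\<^sub>v (toeplitz n f *\<^sub>v Matrix.vec n (fps_nth u))"
      using assoc_mult_mat_vec[of "toeplitz n f ^\<^sub>m k" n n "toeplitz n f" n] by simp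
    thus ?case using Suc by (simp add: toeplitz_mult_vec mult_ac)
  qed (simp add: one_mult_mat_vec[of _ n] toeplitz_def)
  have "toeplitz n f ^\<^sub>m n = 0\<^sub>m n n"
  proof (rule eq_matI)
    fix i j assume "i < dim_row (0\<^sub>m n n :: complex Matrix.mat)" "j < dim_col (0\<^sub>m n n :: complex Matrix.mat)"
    hence ij: "i < n" "j < n" by auto
    define u :: "complex fps" where "u = Abs_fps (vec_index (unit_vec n j))"
    have u: "unit_vec n j = Matrix.vec n (fps_nth u)"
      unfolding u_def by (rule vec_eq_fps_coeffs) simp
    have dims: "dim_row (toeplitz n f ^\<^sub>m n) = n" "dim_col (toeplitz n f ^\<^sub>m n) = n"
      by (auto simp: toeplitz_def)
    have "(toeplitz n f ^\<^sub>m n) $$ (i, j) = vec_index (toeplitz n f ^\<^sub>m n *\<^sub>v unit_vec n j) i"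
      using ij dims by (simp add: scalar_prod_right_unit)
    also have "\<dots> = fps_nth (f ^ n * u) i" unfolding u pow using ij by simp
    also have "\<dots> = 0"
    proof -
      have "fps_nth (f ^ n) k = 0" if "k \<le> i" for k
        using that ij assms startsby_zero_power_prefix[of f] by auto
      thus ?thesis by (simp add: fps_mult_nth)
    qed
    finally show "(toeplitz n f ^\<^sub>m n) $$ (i, j) = 0\<^sub>m n n $$ (i, j)" using ij by simp
  qed (auto simp: toeplitz_def)
  thus ?thesis unfolding nilpotent_mat_def by (intro exI[of _ n]) (simp add: toeplitz_def)
qed

text \<open>For \<open>d > 0\<close> the reciprocal of \<open>p - z\<close> is analytic near the
  closed disc and at most \<open>1 / d\<close> on the circle. The coefficient bound applies to
  multiplication by it, which inverts the Toeplitz matrix of \<open>p - z\<close>.\<close>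

lemma Psi_toeplitz_ge:
  assumes n: "n > 0" and d: "\<And>w. cmod w \<le> 1 \<Longrightarrow> d \<le> cmod (poly p w - z)"
  shows "d \<le> Psi (toeplitz n (fps_of_poly p)) z"
proof (cases "d \<le> 0")
  case True
  thus ?thesis using Psi_nonneg[OF toeplitz_carrier n] order_trans by blast
next
  case False
  define f where "f = fps_of_poly p - fps_const z"
  have f: "f = fps_of_poly (p - [:z:])" by (simp add: f_def fps_of_poly_diff)
  have ev: "eval_fps f w = poly p w - z" for w by (simp add: f)
  have "open {w. poly p w \<noteq> z}" by (intro open_Collect_neq continuous_intros)
  moreover have "cball 0 1 \<subseteq> {w. poly p w \<noteq> z}" using d False by fastforce
  \<comment> \<open>By compactness \<open>p - z\<close> stays nonzero slightly beyond the disc,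
    which pushes the radius of convergence of the reciprocal above 1.\<close>
  ultimately obtain e where e: "e > 0" "(\<Union>x\<in>cball 0 1. ball x e) \<subseteq> {w. poly p w \<noteq> z}"
    using compact_subset_open_imp_ball_epsilon_subset[OF compact_cball] by metis
  have nz: "eval_fps f w \<noteq> 0" if "ereal (norm w) < ereal (1 + e)" for w
  proof -
    have "\<exists>x\<in>cball 0 1. w \<in> ball x e"
    proof (cases "cmod w \<le> 1")
      case True
      thus ?thesis using e by (intro bexI[of _ w]) auto
    next
      case False
      hence w0: "w \<noteq> 0" by auto
      \<comment> \<open>The radial projection of \<open>w\<close> to the circle lies at distance
        \<open>cmod w - 1 < e\<close> from \<open>w\<close>.\<close>
      hence "dist (w / of_real (cmod w)) w = cmod (w * (1 / of_real (cmod w) - 1))"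
        by (simp add: dist_norm algebra_simps)
      also have "\<dots> = cmod w * \<bar>1 / cmod w - 1\<bar>"
        unfolding norm_mult by (metis norm_of_real of_real_1 of_real_diff of_real_divide)
      also have "\<dots> = cmod w - 1" using False w0 by (simp add: abs_if field_simps)
      finally show ?thesis using that False
        by (intro bexI[of _ "w / of_real (cmod w)"]) (auto simp: norm_divide)
    qed
    hence "w \<in> {w. poly p w \<noteq> z}" using e(2) by blast
    thus ?thesis by (simp add: ev)
  qed
  have rad: "fps_conv_radius (inverse f) > 1"
  proof -
    have "1 < min (ereal (1 + e)) (fps_conv_radius f)" using e(1) by (simp add: f)
    also have "\<dots> \<le> fps_conv_radius (inverse f)" by (rule fps_conv_radius_inverse[OF nz])
    finally show ?thesis .
  qed
  have bd: "cmod (eval_fps (inverse f) w) \<le> 1 / d" if w: "cmod w = 1" for w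
  proof -
    have "eval_fps (inverse f) w = inverse (eval_fps f w)"
      using eval_fps_inverse[of "ereal (1 + e)" f w, OF nz] w e(1) by (simp add: f)
    moreover have "d \<le> cmod (eval_fps f w)" using d[of w] w by (simp add: ev)
    ultimately show ?thesis using False by (simp add: norm_inverse divide_inverse le_imp_inverse_le)
  qed
  have "fps_nth f 0 \<noteq> 0" using nz[of 0] e by (simp add: eval_fps_at_0)
  hence inv: "inverse f * f = 1" by (rule inverse_mult_eq_1)
  show ?thesis unfolding le_Psi_iff[OF toeplitz_carrier n] toeplitz_minus_smult_one f_def[symmetric]
  proof
    fix v :: "complex Matrix.vec" assume "v \<in> carrier_vec n"
    then obtain u where v: "v = Matrix.vec n (fps_nth u)" using vec_eq_fps_coeffs by blast
    \<comment> \<open>\<open>f * u\<close> represents the image vector, and multiplying by the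
      reciprocal recovers \<open>u\<close>.\<close>
    have u: "inverse f * (f * u) = u" unfolding mult.assoc[symmetric] inv by simp
    have "(vec_norm2 v)\<^sup>2 \<le> (1 / d * vec_norm2 (toeplitz n f *\<^sub>v v))\<^sup>2"
      using fps_mult_coeffs_l2_bound[OF rad bd, where n = n and u = "f * u"]
      unfolding u v toeplitz_mult_vec power_mult_distrib vec_norm2_fps .
    hence "vec_norm2 v \<le> 1 / d * vec_norm2 (toeplitz n f *\<^sub>v v)"
      by (rule power2_le_imp_le) (use False in simp)
    thus "d * vec_norm2 v \<le> vec_norm2 (toeplitz n f *\<^sub>v v)" using False by (simp add: field_simps)
  qed
qed

text \<open>One \<open>n\<close> serves all \<open>z\<close>, because the residual of the trial
  vector does not depend on \<open>z\<close>.\<close>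

lemma Psi_toeplitz_le:
  assumes eta: "\<eta> > 0"
  obtains n where "n > 0" "\<And>z. Psi (toeplitz n (fps_of_poly p)) z \<le> cmod (poly p 1 - z) + \<eta>"
proof -
  \<comment> \<open>The deviation of a partial coefficient sum from \<open>poly p 1\<close>. It
    vanishes from the degree on, so \<open>E\<close> bounds the residual independently of
    \<open>n\<close>.\<close>
  define e where "e i = (\<Sum>j\<le>i. coeff p j) - poly p 1" for i
  have e0: "e i = 0" if "i \<ge> degree p" for i
  proof -
    have "(\<Sum>j\<le>i. coeff p j) = (\<Sum>j\<le>degree p. coeff p j)"
      by (rule sum.mono_neutral_right) (use that in \<open>auto simp: coeff_eq_0\<close>)
    thus ?thesis by (simp add: e_def poly_altdef)
  qed
  define E where "E = (\<Sum>i<degree p. cmod (e i))"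
  \<comment> \<open>Chosen so that \<open>E \<le> \<eta> * sqrt (real n)\<close>; the added 1 makes
    \<open>n\<close> positive.\<close>
  define n where "n = nat \<lceil>(E / \<eta>)\<^sup>2\<rceil> + 1"
  have n: "n > 0" by (simp add: n_def)
  have "(E / \<eta>)\<^sup>2 \<le> real n" unfolding n_def by linarith
  hence "E / \<eta> \<le> sqrt (real n)" by (rule real_le_rsqrt)
  hence En: "E \<le> \<eta> * sqrt (real n)" using eta by (simp add: field_simps)
  show ?thesis
  proof (rule that[OF n])
    fix z
    \<comment> \<open>The constant vector is an approximate eigenvector for \<open>poly p 1\<close>: the error lives in the first
      \<open>degree p\<close> entries, while the norm is \<open>sqrt n\<close>.\<close>
    define u :: "complex fps" where "u = Abs_fps (\<lambda>_. 1)"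
    define v where "v = Matrix.vec n (fps_nth u)"
    have nv: "vec_norm2 v = sqrt (real n)" by (simp add: v_def u_def vec_norm2_def)
    have v: "v \<in> carrier_vec n" by (simp add: v_def)
    have "fps_nth ((fps_of_poly p - fps_const z) * u) i = (poly p 1 - z) + e i" for i
      by (simp add: left_diff_distrib fps_mult_nth[of "fps_of_poly p"] u_def e_def atLeast0AtMost)
    hence "(toeplitz n (fps_of_poly p) - z \<cdot>\<^sub>m 1\<^sub>m n) *\<^sub>v v = (poly p 1 - z) \<cdot>\<^sub>v v + Matrix.vec n e"
      unfolding toeplitz_minus_smult_one v_def toeplitz_mult_vec by (intro eq_vecI) (auto simp: u_def)
    hence "vec_norm2 ((toeplitz n (fps_of_poly p) - z \<cdot>\<^sub>m 1\<^sub>m n) *\<^sub>v v)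
        \<le> cmod (poly p 1 - z) * sqrt (real n) + vec_norm2 (Matrix.vec n e)"
      using vec_norm2_triangle[of "(poly p 1 - z) \<cdot>\<^sub>v v" n "Matrix.vec n e"] v
      by (simp add: vec_norm2_smult nv)
    also have "vec_norm2 (Matrix.vec n e) \<le> (\<Sum>i<n. cmod (e i))"
      unfolding vec_norm2_eq_L2_set by (rule order_trans[OF L2_set_le_sum]) auto
    also have "\<dots> = (\<Sum>i\<in>{..<n} \<inter> {..<degree p}. cmod (e i))"
      by (rule sum.mono_neutral_right) (auto intro: e0 leI)
    also have "\<dots> \<le> E" unfolding E_def by (rule sum_mono2) auto
    also have "E \<le> \<eta> * sqrt (real n)" by (rule En)
    finally show "Psi (toeplitz n (fps_of_poly p)) z \<le> cmod (poly p 1 - z) + \<eta>"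
      using n by (intro Psi_le[OF toeplitz_carrier n v]) (simp_all add: nv algebra_simps)
  qed
qed

section \<open>Polynomial discs inside a domain\<close>

text \<open>Near 1 the ball of radius \<open>r\<close> has room for the full displacement
  \<open>w\<close>; elsewhere the image has only the compactness margin \<open>\<rho>\<close>, so
  the perturbation has to be small there.\<close>

lemma polynomial_disc_extend:
  fixes p :: "complex poly"
  assumes U: "open U" and p: "\<And>z. cmod z \<le> 1 \<Longrightarrow> poly p z \<in> U"
    and r: "ball (poly p 1) r \<subseteq> U" and w: "cmod w < r"
  obtains p' where "poly p' 0 = poly p 0" "poly p' 1 = poly p 1 + w" "\<And>z. cmod z \<le> 1 \<Longrightarrow> poly p' z \<in> U"
proof -
  have "compact (poly p ` cball 0 1)" by (intro compact_continuous_image continuous_intros compact_cball)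
  moreover have "poly p ` cball 0 1 \<subseteq> U" using p by auto
  ultimately obtain \<rho> where \<rho>: "\<rho> > 0" "(\<Union>x\<in>poly p ` cball 0 1. ball x \<rho>) \<subseteq> U"
    using compact_subset_open_imp_ball_epsilon_subset[OF _ U] by metis
  have "isCont (poly p) 1" by simp
  \<comment> \<open>\<open>\<eta>\<close> marks the region near 1 where \<open>p\<close> changed by
    at most \<open>cmod w\<close> remains in the ball.\<close>
  then obtain \<eta> where \<eta>: "\<eta> > 0" "\<And>z. dist z 1 < \<eta> \<Longrightarrow> dist (poly p z) (poly p 1) < r - cmod w"
    using w unfolding continuous_at_eps_delta by (metis diff_gt_0_iff_gt)
  \<comment> \<open>By the parallelogram law \<open>\<theta>\<close> bounds
    \<open>cmod ((1 + z) / 2)\<close> on the part of the disc at distance at least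
    \<open>\<eta>\<close> from 1; \<open>max 0\<close> covers \<open>\<eta> > 2\<close>.\<close>
  define \<theta> where "\<theta> = sqrt (max 0 (1 - \<eta>\<^sup>2 / 4))"
  have \<theta>: "0 \<le> \<theta>" "\<theta> < 1" using \<eta>(1) by (auto simp: \<theta>_def)
  have "(\<lambda>N. cmod w * \<theta> ^ N) \<longlonglongrightarrow> cmod w * 0"
    using \<theta> by (intro tendsto_intros) auto
  hence "eventually (\<lambda>N. cmod w * \<theta> ^ N < \<rho>) sequentially"
    using \<rho>(1) by (simp add: order_tendsto_iff)
  then obtain N where N: "cmod w * \<theta> ^ N < \<rho>" by (auto simp: eventually_sequentially)
  \<comment> \<open>\<open>((1 + z) / 2) ^ N\<close> peaks at \<open>1\<close>: the perturbation is bounded by \<open>cmod w\<close> near \<open>1\<close>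
    and uniformly small on the rest of the disc.\<close>
  define p' where "p' = p + [:0, w:] * [:1/2, 1/2:] ^ N"
  have ev: "poly p' z = poly p z + w * z * ((1 + z) / 2) ^ N" for z
    by (simp add: p'_def add_divide_distrib mult_ac)
  show ?thesis
  proof
    show "poly p' 0 = poly p 0" "poly p' 1 = poly p 1 + w" by (simp_all add: ev)
    fix z :: complex assume z: "cmod z \<le> 1"
    show "poly p' z \<in> U"
    proof (cases "dist z 1 < \<eta>")
      case True
      have "cmod ((1 + z) / 2) \<le> 1" using z norm_triangle_ineq[of 1 z] by (simp add: norm_divide)
      hence "cmod (w * z * ((1 + z) / 2) ^ N) \<le> cmod w * 1 * 1"
        unfolding norm_mult norm_power using z by (intro mult_mono power_le_one) auto
      moreover have "dist (poly p' z) (poly p 1) \<le> dist (poly p z) (poly p 1) + cmod (w * z * ((1 + z) / 2) ^ N)"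
        unfolding ev dist_norm by (metis add_diff_eq add.commute norm_triangle_ineq)
      ultimately have "poly p' z \<in> ball (poly p 1) r" using \<eta>(2)[OF True] by (simp add: dist_commute)
      thus ?thesis using r by blast
    next
      case False
      have "(cmod (1 + z))\<^sup>2 + (dist z 1)\<^sup>2 = 2 + 2 * (cmod z)\<^sup>2"
        unfolding dist_norm cmod_power2 by (simp add: power2_eq_square algebra_simps)
      moreover have "(cmod z)\<^sup>2 \<le> 1" using z by (simp add: power_le_one)
      moreover have "\<eta>\<^sup>2 \<le> (dist z 1)\<^sup>2" using False \<eta>(1) by (intro power_mono) auto
      ultimately have "(cmod ((1 + z) / 2))\<^sup>2 \<le> 1 - \<eta>\<^sup>2 / 4" by (simp add: norm_divide power_divide)
      hence "cmod ((1 + z) / 2) \<le> \<theta>" unfolding \<theta>_def by (intro real_le_rsqrt) auto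
      hence "cmod (w * z * ((1 + z) / 2) ^ N) \<le> cmod w * 1 * \<theta> ^ N"
        unfolding norm_mult norm_power using z \<theta> by (intro mult_mono power_mono) auto
      hence "poly p' z \<in> ball (poly p z) \<rho>" using N by (simp add: ev dist_norm)
      thus ?thesis using \<rho>(2) z by (auto simp: subset_eq)
    qed
  qed
qed

text \<open>The set \<open>S\<close> of reachable endpoints contains 0 and is open and relatively
  closed in \<open>U\<close>, so connectedness makes it all of \<open>U\<close>.\<close>

lemma polynomial_disc_to_point:
  assumes U: "open U" "connected U" "0 \<in> U" and q: "q \<in> U"
  obtains p :: "complex poly" where "poly p 0 = 0" "poly p 1 = q" "\<And>z. cmod z \<le> 1 \<Longrightarrow> poly p z \<in> U"
proof -
  define S where "S = {q. \<exists>p :: complex poly. poly p 0 = 0 \<and> poly p 1 = q \<and> (\<forall>z. cmod z \<le> 1 \<longrightarrow> poly p z \<in> U)}"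
  have SU: "S \<subseteq> U" by (auto simp: S_def)
  have "0 \<in> S" using U(3) unfolding S_def by (auto intro!: exI[of _ 0])
  have ext: "ball q r \<subseteq> S" if qS: "q \<in> S" and r: "ball q r \<subseteq> U" for q r
  proof
    fix x assume x: "x \<in> ball q r"
    from qS obtain p where p: "poly p 0 = 0" "poly p 1 = q" "\<And>z. cmod z \<le> 1 \<Longrightarrow> poly p z \<in> U"
      by (auto simp: S_def)
    have "ball (poly p 1) r \<subseteq> U" "cmod (x - q) < r"
      using r p x by (auto simp: dist_norm norm_minus_commute)
    from polynomial_disc_extend[OF U(1) p(3) this] obtain p' where
      "poly p' 0 = poly p 0" "poly p' 1 = poly p 1 + (x - q)" "\<And>z. cmod z \<le> 1 \<Longrightarrow> poly p' z \<in> U"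
      by blast
    thus "x \<in> S" unfolding S_def using p by auto
  qed
  have "open S" unfolding open_contains_ball using ext SU U(1) open_contains_ball by (metis subsetD)
  moreover have "open (U - S)" unfolding open_contains_ball
  proof
    fix x assume x: "x \<in> U - S"
    then obtain r where r: "r > 0" "ball x r \<subseteq> U" using U(1) open_contains_ball by blast
    \<comment> \<open>Half the radius makes the argument symmetric: a reachable \<open>y\<close> has
      a ball of radius \<open>r / 2\<close> inside \<open>U\<close> that contains \<open>x\<close>,
      so \<open>x\<close> would be reachable.\<close>
    have "y \<notin> S" if y: "y \<in> ball x (r / 2)" for y
    proof
      assume "y \<in> S"
      moreover have "ball y (r / 2) \<subseteq> U"
      proof -
        have "ball y (r / 2) \<subseteq> ball x r"
        proof
          fix t assume "t \<in> ball y (r / 2)"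
          thus "t \<in> ball x r" using y dist_triangle[of x t y] by simp
        qed
        thus ?thesis using r by blast
      qed
      ultimately have "ball y (r / 2) \<subseteq> S" by (rule ext)
      hence "x \<in> S" using y by (auto simp: dist_commute)
      thus False using x by simp
    qed
    thus "\<exists>e>0. ball x e \<subseteq> U - S" using r
      by (intro exI[of _ "r / 2"]) (auto simp: subset_eq)
  qed
  ultimately have "S \<inter> U = {} \<or> (U - S) \<inter> U = {}"
    using connectedD[OF U(2), of S "U - S"] by blast
  hence "q \<in> S" using \<open>0 \<in> S\<close> U(3) q by blast
  thus ?thesis using that by (auto simp: S_def)
qed

section \<open>Assembling the blocks\<close>

text \<open>One block per target point: the disc staying in \<open>U\<close> gives the lower bound,
  and \<open>poly p 1 = q\<close> gives the upper bound.\<close>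

lemma exists_nilpotent_Psi_le_dist:
  assumes U: "open U" "connected U" "0 \<in> U" and q: "q \<in> U" and eta: "\<eta> > 0"
  obtains n T where "n > 0" "T \<in> carrier_mat n n" "nilpotent_mat T"
    "\<And>z. infdist z U \<le> Psi T z" "\<And>z. Psi T z \<le> dist q z + \<eta>"
proof -
  obtain p :: "complex poly" where p: "poly p 0 = 0" "poly p 1 = q" "\<And>z. cmod z \<le> 1 \<Longrightarrow> poly p z \<in> U"
    using polynomial_disc_to_point[OF U q] by blast
  obtain n where n: "n > 0" "\<And>z. Psi (toeplitz n (fps_of_poly p)) z \<le> cmod (poly p 1 - z) + \<eta>"
    using Psi_toeplitz_le[OF eta, of p] by blast
  show ?thesis
  proof (rule that[OF n(1) toeplitz_carrier])
    show "nilpotent_mat (toeplitz n (fps_of_poly p))"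
      using p(1) by (intro nilpotent_toeplitz) (simp add: poly_0_coeff_0)
    show "infdist z U \<le> Psi (toeplitz n (fps_of_poly p)) z" for z
    proof (rule Psi_toeplitz_ge[OF n(1)])
      fix w assume "cmod w \<le> 1"
      from infdist_le[OF p(3)[OF this]] show "infdist z U \<le> cmod (poly p w - z)"
        by (simp add: dist_norm norm_minus_commute)
    qed
    show "Psi (toeplitz n (fps_of_poly p)) z \<le> dist q z + \<eta>" for z
      using n(2)[of z] p(2) by (simp add: dist_norm)
  qed
qed

text \<open>\<open>Psi\<close> of a direct sum is the minimum, so the common lower bound survives
  while each summand contributes the upper bound at its own \<open>q\<close>.\<close>

lemma exists_nilpotent_Psi_le_dist_finite:
  assumes U: "open U" "connected U" "0 \<in> U" and eta: "\<eta> > 0"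
    and Q: "finite Q" "Q \<noteq> {}" "Q \<subseteq> U"
  obtains n T where "n > 0" "T \<in> carrier_mat n n" "nilpotent_mat T"
    "\<And>z. infdist z U \<le> Psi T z" "\<And>q z. q \<in> Q \<Longrightarrow> Psi T z \<le> dist q z + \<eta>"
proof -
  from Q have "\<exists>n T. n > 0 \<and> T \<in> carrier_mat n n \<and> nilpotent_mat T \<and>
    (\<forall>z. infdist z U \<le> Psi T z) \<and> (\<forall>q\<in>Q. \<forall>z. Psi T z \<le> dist q z + \<eta>)"
  proof (induction Q rule: finite_ne_induct)
    case (singleton q)
    thus ?case using exists_nilpotent_Psi_le_dist[OF U _ eta, of q] by (metis insert_subset singletonD)
  next
    case (insert q Q)
    have "Q \<subseteq> U" using insert.prems by simp
    from insert.IH[OF this] obtain n T where T: "n > 0" "T \<in> carrier_mat n n" "nilpotent_mat T"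
      "\<And>z. infdist z U \<le> Psi T z" "\<And>q z. q \<in> Q \<Longrightarrow> Psi T z \<le> dist q z + \<eta>" by blast
    have "q \<in> U" using insert.prems by simp
    from exists_nilpotent_Psi_le_dist[OF U this eta] obtain k S where S: "k > 0" "S \<in> carrier_mat k k" "nilpotent_mat S"
      "\<And>z. infdist z U \<le> Psi S z" "\<And>z. Psi S z \<le> dist q z + \<eta>" by metis
    note Psi = Psi_direct_sum[OF T(2,1) S(2,1)]
    show ?case
      by (rule exI[of _ "n + k"], rule exI[of _ "direct_sum T S"])
        (use T S direct_sum_carrier[OF T(2) S(2)] nilpotent_direct_sum[OF T(2) S(2) T(3) S(3)]
         in \<open>auto simp: Psi min_le_iff_disj\<close>)
  qed
  thus ?thesis using that by metis
qed

section \<open>Squeezing a pseudospectrum between two domains\<close>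

lemma pseudospectrum_direct_sum:
  assumes "A \<in> carrier_mat n n" "n > 0" "B \<in> carrier_mat m m" "m > 0"
  shows "pseudospectrum \<epsilon> (direct_sum A B) = pseudospectrum \<epsilon> A \<union> pseudospectrum \<epsilon> B"
  by (auto simp: pseudospectrum_def Psi_direct_sum[OF assms])

text \<open>Since \<open>infdist\<close> is continuous, the right side is closed and absorbs the
  closure.\<close>

lemma closure_pseudospectrum_subset:
  assumes "\<And>z. infdist z X \<le> Psi T z"
  shows "closure (pseudospectrum \<epsilon> T) \<subseteq> {z. infdist z X \<le> \<epsilon>}"
proof (rule closure_minimal)
  show "pseudospectrum \<epsilon> T \<subseteq> {z. infdist z X \<le> \<epsilon>}"
    using assms by (fastforce simp: pseudospectrum_def intro: order_trans less_imp_le)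
  show "closed {z. infdist z X \<le> \<epsilon>}"
    by (intro closed_Collect_le continuous_intros)
qed

text \<open>Blocks built for \<open>U\<close>, the \<open>\<delta>\<close>-neighbourhood of
  \<open>G\<close>, have their pseudospectrum within \<open>\<delta> + \<epsilon> = \<rho>\<close>
  of \<open>G\<close>, while a net pushes \<open>Psi\<close> below \<open>\<epsilon>\<close> on
  \<open>closure G\<close>. The last conclusion controls the new block at the larger thresholds of
  earlier levels.\<close>

lemma exists_nilpotent_pseudospectrum_between:
  fixes G G' :: "complex set"
  assumes G: "connected G" "bounded G" "0 \<in> G" and eps: "0 < \<epsilon>" "\<epsilon> < \<rho>"
    and G': "\<And>z. infdist z G \<le> \<rho> \<Longrightarrow> z \<in> G'"
  obtains n T where "n > 0" "T \<in> carrier_mat n n" "nilpotent_mat T"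
    "cc_in G (pseudospectrum \<epsilon> T)" "cc_in (pseudospectrum \<epsilon> T) G'" "\<And>z. infdist z G' \<le> Psi T z"
proof -
  define \<delta> where "\<delta> = \<rho> - \<epsilon>"
  have \<delta>: "\<delta> > 0" using eps by (simp add: \<delta>_def)
  define U where "U = (\<Union>x\<in>G. ball x \<delta>)"
  \<comment> \<open>As a Minkowski sum, \<open>U\<close> is a continuous image of a connected
    product.\<close>
  have "U = (\<lambda>(x, y). x + y) ` (G \<times> ball 0 \<delta>)"
  proof safe
    fix z assume "z \<in> U"
    then obtain x where "x \<in> G" "dist x z < \<delta>" by (auto simp: U_def)
    thus "z \<in> (\<lambda>(x, y). x + y) ` (G \<times> ball 0 \<delta>)"
      by (intro image_eqI[of _ _ "(x, z - x)"]) (auto simp: dist_norm norm_minus_commute)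
  next
    fix x y assume "x \<in> G" "y \<in> ball (0 :: complex) \<delta>"
    thus "x + y \<in> U" unfolding U_def by (intro UN_I[of x]) (auto simp: dist_norm)
  qed
  moreover have "connected ((\<lambda>(x, y). x + y) ` (G \<times> ball (0 :: complex) \<delta>))"
    unfolding case_prod_unfold
    by (intro connected_continuous_image connected_Times G(1) connected_ball continuous_intros)
  ultimately have "connected U" by simp
  hence U: "open U" "connected U" "0 \<in> U" using G(3) \<delta> by (auto simp: U_def intro: bexI[of _ 0])
  have GU: "infdist z G - \<delta> \<le> infdist z U" for z
    unfolding infdist_notempty[OF ex_in_conv[THEN iffD1, OF exI, OF U(3)]]
  proof (rule cINF_greatest)
    fix u assume "u \<in> U"
    then obtain x where x: "x \<in> G" "dist x u < \<delta>" by (auto simp: U_def)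
    have "infdist z G \<le> dist z x" using x(1) by (rule infdist_le)
    also have "\<dots> \<le> dist z u + dist x u" by (rule dist_triangle2)
    finally show "infdist z G - \<delta> \<le> dist z u" using x by linarith
  qed (use U in auto)
  have UG': "U \<subseteq> G'"
  proof
    fix u assume "u \<in> U"
    with GU[of u] \<delta> eps have "infdist u G \<le> \<rho>" by (simp add: \<delta>_def)
    thus "u \<in> G'" by (rule G')
  qed
  have "compact (closure G)" using G(2) by (simp add: compact_closure)
  moreover have "closure G \<subseteq> (\<Union>q\<in>closure G. ball q (\<epsilon> / 2))" using eps by auto
  \<comment> \<open>Mesh \<open>\<epsilon> / 2\<close> of the net plus block error
    \<open>\<epsilon> / 2\<close> puts \<open>Psi\<close> strictly below \<open>\<epsilon>\<close>
    on \<open>closure G\<close>.\<close>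
  ultimately obtain Q where Q: "Q \<subseteq> closure G" "finite Q" "closure G \<subseteq> (\<Union>q\<in>Q. ball q (\<epsilon> / 2))"
    by (metis compactE_image open_ball)
  have "closure G \<subseteq> U" using \<delta> by (auto simp: U_def closure_approachable)
  hence "Q \<subseteq> U" using Q(1) by blast
  moreover have "Q \<noteq> {}" using Q(3) G(3) closure_subset by fastforce
  ultimately obtain n T where T: "n > 0" "T \<in> carrier_mat n n" "nilpotent_mat T"
    "\<And>z. infdist z U \<le> Psi T z" "\<And>q z. q \<in> Q \<Longrightarrow> Psi T z \<le> dist q z + \<epsilon> / 2"
    using exists_nilpotent_Psi_le_dist_finite[OF U, of "\<epsilon> / 2" Q] eps Q(2) by (metis half_gt_zero)
  show ?thesis
  proof (rule that[OF T(1-3)])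
    show "cc_in G (pseudospectrum \<epsilon> T)" unfolding cc_in_def
    proof
      fix z assume "z \<in> closure G"
      then obtain q where "q \<in> Q" "dist q z < \<epsilon> / 2" using Q(3) by auto
      thus "z \<in> pseudospectrum \<epsilon> T" using T(5)[of q z] by (simp add: pseudospectrum_def)
    qed
    show "cc_in (pseudospectrum \<epsilon> T) G'" unfolding cc_in_def
    proof
      fix z assume "z \<in> closure (pseudospectrum \<epsilon> T)"
      hence "infdist z U \<le> \<epsilon>" using closure_pseudospectrum_subset[OF T(4)] by blast
      thus "z \<in> G'" using GU[of z] by (intro G') (simp add: \<delta>_def)
    qed
    show "infdist z G' \<le> Psi T z" for z
      using infdist_mono[OF UG', of z] U(3) T(4)[of z] by fastforce
  qed
qed

section \<open>Nested domains and the induction over the levels\<close>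

text \<open>A segment from the nearest point of \<open>closure G\<close> to a point outside
  \<open>H\<close> meets \<open>frontier H\<close>, and on the way there \<open>frontier G\<close>,
  so it is at least as long as the distance of the frontiers. This turns the bound on
  \<open>\<epsilon>1\<close> into a neighbourhood inclusion.\<close>

lemma infdist_le_setdist_frontier_imp_mem:
  fixes G H :: "complex set"
  assumes H: "open H" and G: "open G" "bounded G" "G \<noteq> {}" "closure G \<subseteq> H"
    and r: "r < setdist (frontier H) (frontier G)" and z: "infdist z G \<le> r"
  shows "z \<in> H"
proof (rule ccontr)
  assume zH: "z \<notin> H"
  have "closure G \<noteq> {}" using G(3) by auto
  then obtain x where x: "x \<in> closure G" "infdist z (closure G) = dist z x"
    using infdist_attains_inf[OF closed_closure] by metis
  have "dist z x \<le> r"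
    using x(2) z infdist_mono[OF closure_subset G(3), of z] by simp
  have "x \<in> closed_segment x z \<inter> H" "z \<in> closed_segment x z - H" using x(1) G(4) zH by auto
  then obtain b where b: "b \<in> closed_segment x z" "b \<in> frontier H"
    using connected_Int_frontier[OF connected_segment(1), of x z H] by blast
  have "b \<notin> H" using b(2) H by (simp add: frontier_def interior_open)
  hence bG: "b \<notin> closure G" using G(4) by blast
  \<comment> \<open>If \<open>x\<close> lies outside the open set \<open>G\<close>, it is itself a
    frontier point and serves as \<open>a\<close>.\<close>
  obtain a where a: "a \<in> closed_segment x b" "a \<in> frontier G"
  proof (cases "x \<in> G")
    case True
    hence "x \<in> closed_segment x b \<inter> G" "b \<in> closed_segment x b - G" using bG closure_subset by auto
    thus ?thesis using connected_Int_frontier[OF connected_segment(1), of x b G] that by blast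
  next
    case False
    thus ?thesis using that[of x] x(1) G(1) by (simp add: frontier_def interior_open)
  qed
  have "setdist (frontier H) (frontier G) \<le> dist b a" by (rule setdist_le_dist) (use a b in auto)
  also have "\<dots> \<le> dist x b" using segment_bound(2)[OF a(1)] by (simp add: dist_norm norm_minus_commute)
  also have "\<dots> \<le> dist z x" using segment_bound(1)[OF b(1)] by (simp add: dist_norm norm_minus_commute)
  finally show False using \<open>dist z x \<le> r\<close> r by simp
qed

text \<open>Compactness of \<open>closure G\<close> gives a uniform margin. This supplies the room
  at the levels after the first, where the threshold may be taken as small as desired.\<close>

lemma cc_in_imp_infdist_neighbourhood:
  assumes "open H" "bounded G" "G \<noteq> {}" "cc_in G H"
  obtains \<rho> where "\<rho> > 0" "\<And>z. infdist z G \<le> \<rho> \<Longrightarrow> z \<in> H"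
proof -
  have "compact (closure G)" using assms(2) by (simp add: compact_closure)
  then obtain e where e: "e > 0" "(\<Union>x\<in>closure G. ball x e) \<subseteq> H"
    using compact_subset_open_imp_ball_epsilon_subset assms(1,4) unfolding cc_in_def by metis
  show ?thesis
  proof
    show "e / 2 > 0" using e by simp
    fix z assume z: "infdist z G \<le> e / 2"
    have "closure G \<noteq> {}" using assms(3) by auto
    then obtain x where x: "x \<in> closure G" "infdist z (closure G) = dist z x"
      using infdist_attains_inf[OF closed_closure] by metis
    hence "dist x z < e"
      using z e(1) infdist_mono[OF closure_subset assms(3), of z] by (simp add: dist_commute)
    thus "z \<in> H" using e(2) x(1) by (meson UN_I mem_ball subsetD)
  qed
qed

theorem theorem4p1:
  fixes G :: "nat \<Rightarrow> complex set" and m :: nat and \<epsilon>1 :: real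
  assumes "m \<ge> 1"
    and "\<And>i. i \<le> m \<Longrightarrow> open (G i) \<and> connected (G i) \<and> bounded (G i) \<and> 0 \<in> G i"
    and "\<And>i. i < m \<Longrightarrow> cc_in (G (Suc i)) (G i)"
    and "0 < \<epsilon>1" and "\<epsilon>1 < setdist (frontier (G 0)) (frontier (G 1))"
  shows "\<exists>(\<epsilon> :: nat \<Rightarrow> real) (n :: nat) (T :: complex Matrix.mat).
           \<epsilon> 1 = \<epsilon>1 \<and> (\<forall>k. 1 \<le> k \<and> k < m \<longrightarrow> \<epsilon> (Suc k) < \<epsilon> k) \<and> \<epsilon> m > 0 \<and>
           0 < n \<and> T \<in> carrier_mat n n \<and> nilpotent_mat T \<and>
           (\<forall>k. 1 \<le> k \<and> k \<le> m \<longrightarrow>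
              cc_in (pseudospectrum (\<epsilon> k) T) (G (k - 1)) \<and>
              cc_in (G k) (pseudospectrum (\<epsilon> k) T))"
proof -
  have antimono: "G j \<subseteq> G i" if "i \<le> j" "j \<le> m" for i j
    using that
  proof (induction j rule: dec_induct)
    case (step j)
    have "G (Suc j) \<subseteq> G j" using assms(3)[of j] step closure_subset[of "G (Suc j)"] by (auto simp: cc_in_def)
    thus ?case using step by auto
  qed auto
  \<comment> \<open>The last conjunct lets blocks be added: for a later block \<open>Psi\<close> is
    at least the distance to \<open>G k\<close>, hence to \<open>G j\<close>, so its
    \<open>\<epsilon> j\<close>-pseudospectrum stays in \<open>G (j - 1)\<close>.\<close>
  let ?P = "\<lambda>k \<epsilon> n T. \<epsilon> 1 = \<epsilon>1 \<and> (\<forall>j. 1 \<le> j \<and> j < k \<longrightarrow> \<epsilon> (Suc j) < \<epsilon> j) \<and> \<epsilon> k > 0 \<and>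
     0 < n \<and> T \<in> carrier_mat n n \<and> nilpotent_mat T \<and>
     (\<forall>j. 1 \<le> j \<and> j \<le> k \<longrightarrow>
        cc_in (pseudospectrum (\<epsilon> j) T) (G (j - 1)) \<and> cc_in (G j) (pseudospectrum (\<epsilon> j) T) \<and>
        (\<forall>z. infdist z (G j) \<le> \<epsilon> j \<longrightarrow> z \<in> G (j - 1)))"
  have "\<exists>\<epsilon> n T. ?P k \<epsilon> n T" if "1 \<le> k" "k \<le> m" for k
    using that
  proof (induction k rule: dec_induct)
    case base
    \<comment> \<open>The slack \<open>\<rho> - \<epsilon>1\<close> is the width by which
      \<open>G 1\<close> gets thickened.\<close>
    obtain \<rho> where \<rho>: "\<epsilon>1 < \<rho>" "\<rho> < setdist (frontier (G 0)) (frontier (G 1))"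
      using dense[OF assms(5)] by blast
    have *: "z \<in> G 0" if "infdist z (G 1) \<le> \<rho>" for z
    proof (rule infdist_le_setdist_frontier_imp_mem[OF _ _ _ _ _ \<rho>(2) that])
      show "open (G 0)" "open (G 1)" "bounded (G 1)" "G 1 \<noteq> {}" "closure (G 1) \<subseteq> G 0"
        using assms(1) assms(2)[of 0] assms(2)[of 1] assms(3)[of 0] by (auto simp: cc_in_def)
    qed
    have "connected (G 1)" "bounded (G 1)" "0 \<in> G 1" using assms(1) assms(2)[of 1] by auto
    from exists_nilpotent_pseudospectrum_between[OF this assms(4) \<rho>(1) *] obtain n T where T:
      "n > 0" "T \<in> carrier_mat n n" "nilpotent_mat T" "cc_in (G 1) (pseudospectrum \<epsilon>1 T)"
      "cc_in (pseudospectrum \<epsilon>1 T) (G 0)" by metis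
    have "?P 1 (\<lambda>_. \<epsilon>1) n T"
      using T assms(4) * \<rho>(1) by (auto simp: le_antisym)
    thus ?case by (intro exI[of _ "\<lambda>_. \<epsilon>1"] exI[of _ n] exI[of _ T])
  next
    case (step k)
    then obtain \<epsilon> n T where P: "?P k \<epsilon> n T" by auto
    hence T: "T \<in> carrier_mat n n" "0 < n" "nilpotent_mat T" by auto
    have k: "1 \<le> k" "Suc k \<le> m" using step by auto
    have Gk: "open (G k)" "0 \<in> G k" using assms(2)[of k] k by auto
    have GS: "connected (G (Suc k))" "bounded (G (Suc k))" "0 \<in> G (Suc k)"
      using assms(2)[of "Suc k"] k by auto
    have "cc_in (G (Suc k)) (G k)" using assms(3) k by simp
    then obtain \<rho> where \<rho>: "\<rho> > 0" "\<And>z. infdist z (G (Suc k)) \<le> \<rho> \<Longrightarrow> z \<in> G k"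
      using cc_in_imp_infdist_neighbourhood[OF Gk(1) GS(2)] GS(3) by (metis empty_iff)
    \<comment> \<open>The old blocks are nilpotent, so at a small enough threshold their
      pseudospectrum fits into this disc.\<close>
    obtain r where r: "r > 0" "cball 0 r \<subseteq> G k" using Gk open_contains_cball by blast
    obtain c where c: "c > 0" "\<And>z. cmod z \<ge> r \<Longrightarrow> c \<le> Psi T z"
      using nilpotent_Psi_bounded_below[OF T r(1)] by blast
    \<comment> \<open>\<open>c\<close> confines the old blocks, \<open>\<rho> / 2\<close> leaves
      room to thicken \<open>G (Suc k)\<close>, and \<open>\<epsilon> k / 2\<close> makes the
      sequence strictly decreasing.\<close>
    define e where "e = min (min c (\<rho> / 2)) (\<epsilon> k / 2)"
    have e: "0 < e" "e < \<rho>" "e \<le> c" "e < \<epsilon> k" using c(1) \<rho>(1) P by (auto simp: e_def min_def)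
    obtain l S where S: "l > 0" "S \<in> carrier_mat l l" "nilpotent_mat S"
      "cc_in (G (Suc k)) (pseudospectrum e S)" "cc_in (pseudospectrum e S) (G k)"
      "\<And>z. infdist z (G k) \<le> Psi S z"
      using exists_nilpotent_pseudospectrum_between[OF GS e(1,2) \<rho>(2)] by metis
    define R where "R = direct_sum T S"
    note ps = pseudospectrum_direct_sum[OF T(1,2) S(2,1), folded R_def]
    have Te: "cc_in (pseudospectrum e T) (G k)"
    proof -
      have "pseudospectrum e T \<subseteq> cball 0 r"
      proof
        fix z assume "z \<in> pseudospectrum e T"
        hence "\<not> c \<le> Psi T z" using e by (simp add: pseudospectrum_def)
        thus "z \<in> cball 0 r" using c(2)[of z] by fastforce
      qed
      hence "closure (pseudospectrum e T) \<subseteq> cball 0 r" by (rule closure_minimal) simp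
      thus ?thesis using r(2) by (auto simp: cc_in_def)
    qed
    \<comment> \<open>The distance to \<open>G j\<close> is at most that to the smaller set
      \<open>G k\<close>, so the last conjunct of the induction hypothesis applies.\<close>
    have Sj: "cc_in (pseudospectrum (\<epsilon> j) S) (G (j - 1))" if j: "1 \<le> j" "j \<le> k" for j
      unfolding cc_in_def
    proof
      fix z assume "z \<in> closure (pseudospectrum (\<epsilon> j) S)"
      hence "infdist z (G k) \<le> \<epsilon> j" using closure_pseudospectrum_subset[OF S(6)] by blast
      moreover have "infdist z (G j) \<le> infdist z (G k)"
        by (rule infdist_mono) (use antimono[of j k] j k Gk in auto)
      ultimately show "z \<in> G (j - 1)" using P j by auto
    qed
    \<comment> \<open>Pseudospectra of \<open>R\<close> are unions: \<open>G j\<close> is covered by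
      the part from \<open>T\<close> for \<open>j \<le> k\<close> and from \<open>S\<close> for
      \<open>j = Suc k\<close>, while the inclusions in \<open>G (j - 1)\<close> have to hold for
      both parts.\<close>
    have "?P (Suc k) (\<epsilon>(Suc k := e)) (n + l) R"
    proof (intro conjI allI impI)
      show "(\<epsilon>(Suc k := e)) 1 = \<epsilon>1" using P k by auto
      show "(\<epsilon>(Suc k := e)) (Suc j) < (\<epsilon>(Suc k := e)) j" if "1 \<le> j \<and> j < Suc k" for j
        using that P e(4) by (cases "j = k") auto
      show "R \<in> carrier_mat (n + l) (n + l)" "nilpotent_mat R"
        unfolding R_def using direct_sum_carrier nilpotent_direct_sum T S by auto
      fix j assume j: "1 \<le> j \<and> j \<le> Suc k"
      show "cc_in (pseudospectrum ((\<epsilon>(Suc k := e)) j) R) (G (j - 1))"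
        using Te S(5) Sj[of j] P j by (auto simp: ps cc_in_def closure_Un le_Suc_eq)
      show "cc_in (G j) (pseudospectrum ((\<epsilon>(Suc k := e)) j) R)"
        using S(4) P j by (auto simp: ps cc_in_def le_Suc_eq)
      show "z \<in> G (j - 1)" if "infdist z (G j) \<le> (\<epsilon>(Suc k := e)) j" for z
        using that \<rho>(2)[of z] e(2) P j by (auto simp: le_Suc_eq)
    qed (use e T in auto)
    thus ?case by blast
  qed
  from this[OF assms(1) order_refl] show ?thesis by blast
qed

end
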